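(* Suppose $\ker\begin{bmatrix}X_-R_-^\top\\ U_-R_-^\top\end{bmatrix}^\top=\{0\}$, let $\sigma_{(U_-,X)}^1,\dots,\sigma_{(U_-,X)}^L\in\mathbb{R}^{n\times(n+m)}$ be the vertices of the convex polytope $\Sigma_{(U_-,X)}^R$, and let $\gamma>0$. The data $(U_-,X)$ are informative for common $\mathcal{H}_\infty$ control with performance $\gamma$ if and only if there exist $K\in\mathbb{R}^{m\times n}$ and a symmetric $P\in\mathbb{R}^{n\times n}$ such that $P\succ0$ and for all $i\in\{1,\dots,L\}$: $$\begin{bmatrix}I&0\\ \sigma_{(U_-,X)}^i\begin{bmatrix}I\\ K\end{bmatrix}&I\\ 0&I\\ C&D\end{bmatrix}^\top\begin{bmatrix}-P&0&0&0\\ 0&P&0&0\\ 0&0&-\gamma^2I&0\\ 0&0&0&I\end{bmatrix}\begin{bmatrix}I&0\\ \sigma_{(U_-,X)}^i\begin{bmatrix}I\\ K\end{bmatrix}&I\\ 0&I\\ C&D\end{bmatrix}\prec0.$$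
   Context: Let $n,m,M,N,p\ge 1$ be integers. State data $x(0),\dots,x(N)\in\mathbb{R}^n$ and input data $u(0),\dots,u(N-1)\in\mathbb{R}^m$ are collected in $X=[x(0)\ \cdots\ x(N)]$, $X_+=[x(1)\ \cdots\ x(N)]$, $X_-=[x(0)\ \cdots\ x(N-1)]$, $U_-=[u(0)\ \cdots\ u(N-1)]$. An instrumental signal matrix $R_-\in\mathbb{R}^{M\times N}$ and bounds $C_l,C_u\in\mathbb{R}^{n\times M}$ are given. Inequalities $\le$ between matrices are entry-wise; $\succ0$ and $\prec0$ mean symmetric positive definite and symmetric negative definite. The data are generated by a true system $(A_0,B_0)$, i.e. $X_+=A_0X_-+B_0U_-+E_-^0$ for some unknown $E_-^0\in\mathcal{E}_R:=\{E\in\mathbb{R}^{n\times N}\mid C_l\le\tfrac{1}{\sqrt N}ER_-^\top\le C_u\}$. The (hence non-empty) set of feasible systems is $$\Sigma_{(U_-,X)}^R:=\{(A,B)\in\mathbb{R}^{n\times n}\times\mathbb{R}^{n\times m}\mid \exists E_-\in\mathcal{E}_R:\ X_+=AX_-+BU_-+E_-\}.$$ A pair $(A,B)$ is identified with $[A\ \ B]\in\mathbb{R}^{n\times(n+m)}$. Under the kernel condition of the claim, $\Sigma_{(U_-,X)}^R$ is a bounded polyhedron, so it is the convex hull of its finitely many vertices $\sigma_{(U_-,X)}^1,\dots,\sigma_{(U_-,X)}^L$. User-specified performance matrices $C\in\mathbb{R}^{p\times n}$, $D\in\mathbb{R}^{p\times n}$ are given. The data $(U_-,X)$ are informative for common $\mathcal{H}_\infty$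 control with performance $\gamma$ if there exist $K\in\mathbb{R}^{m\times n}$ and $P\succ0$ such that for all $(A,B)\in\Sigma_{(U_-,X)}^R$: $$\begin{bmatrix}I&0\\ A+BK&I\\ 0&I\\ C&D\end{bmatrix}^\top\begin{bmatrix}-P&0&0&0\\ 0&P&0&0\\ 0&0&-\gamma^2I&0\\ 0&0&0&I\end{bmatrix}\begin{bmatrix}I&0\\ A+BK&I\\ 0&I\\ C&D\end{bmatrix}\prec0.$$ *)

theory Defs
  imports "HOL-Analysis.Analysis"
begin

(* [A B] *)
definition hblock :: "real^'a^'r \<Rightarrow> real^'b^'r \<Rightarrow> real^('a + 'b)^'r" where
  "hblock A B = (\<chi> i j. case j of Inl k \<Rightarrow> A $ i $ k | Inr l \<Rightarrow> B $ i $ l)"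

(* [A; B] *)
definition vblock :: "real^'c^'a \<Rightarrow> real^'c^'b \<Rightarrow> real^'c^('a + 'b)" where
  "vblock A B = (\<chi> i. case i of Inl k \<Rightarrow> A $ k | Inr l \<Rightarrow> B $ l)"

definition diagblock :: "real^'c^'a \<Rightarrow> real^'d^'b \<Rightarrow> real^('c + 'd)^('a + 'b)" where
  "diagblock A B = vblock (hblock A 0) (hblock 0 B)"

definition pos_def :: "real^'a^'a \<Rightarrow> bool" where
  "pos_def P \<longleftrightarrow> transpose P = P \<and> (\<forall>v. v \<noteq> 0 \<longrightarrow> v \<bullet> (P *v v) > 0)"

definition neg_def :: "real^'a^'a \<Rightarrow> bool" where
  "neg_def P \<longleftrightarrow> transpose P = P \<and> (\<forall>v. v \<noteq> 0 \<longrightarrow> v \<bullet> (P *v v) < 0)"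

(* The N samples are indexed by a finite linearly ordered type 'N with CARD('N) = N;
   its elements stand, in increasing order, for the times 0, ..., N - 1. *)
definition time_of :: "'N::{finite,linorder} \<Rightarrow> nat" where
  "time_of k = card {..<k}"

(* The matrix with columns z(0), ..., z(N - 1): it is X\<^sub>- for z = x, and U\<^sub>- for z = u. *)
definition data_minus :: "(nat \<Rightarrow> real^'a) \<Rightarrow> real^'N::{finite,linorder}^'a" where
  "data_minus z = (\<chi> i k. z (time_of k) $ i)"

(* The matrix with columns z(1), ..., z(N). *)
definition data_plus :: "(nat \<Rightarrow> real^'a) \<Rightarrow> real^'N::{finite,linorder}^'a" where
  "data_plus z = (\<chi> i k. z (Suc (time_of k)) $ i)"

(* The library order on real^_^_ is the entrywise one. *)
definition noise_set ::
  "real^'M^'n \<Rightarrow> real^'M^'n \<Rightarrow> real^'N^'M \<Rightarrow> (real^'N^'n) set" where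
  "noise_set Cl Cu R =
     {E. Cl \<le> (1 / sqrt (real CARD('N))) *\<^sub>R (E ** transpose R) \<and>
         (1 / sqrt (real CARD('N))) *\<^sub>R (E ** transpose R) \<le> Cu}"

definition feasible_systems ::
  "real^'M^'n \<Rightarrow> real^'M^'n \<Rightarrow> real^'N::{finite,linorder}^'M \<Rightarrow>
   (nat \<Rightarrow> real^'m) \<Rightarrow> (nat \<Rightarrow> real^'n) \<Rightarrow> ((real^'n^'n) \<times> (real^'m^'n)) set" where
  "feasible_systems Cl Cu R u x =
     {(A, B). \<exists>E \<in> noise_set Cl Cu R.
        data_plus x = A ** data_minus x + B ** data_minus u + E}"

(* Left-hand side of the H-infinity matrix inequality; F is the closed-loop matrix A + B K. *)
definition hinf_matrix ::
  "real^'n^'p \<Rightarrow> real^'n^'p \<Rightarrow> real \<Rightarrow> real^'n^'n \<Rightarrow> real^'n^'n \<Rightarrow> real^('n + 'n)^('n + 'n)" where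
  "hinf_matrix C D \<gamma> P F =
    (let Z = vblock (hblock (mat 1) 0)
            (vblock (hblock F (mat 1))
            (vblock (hblock 0 (mat 1))
                    (hblock C D)));
         W = diagblock (- P) (diagblock P
               (diagblock (- (\<gamma>\<^sup>2 *\<^sub>R (mat 1 :: real^'n^'n))) (mat 1 :: real^'p^'p)))
     in transpose Z ** W ** Z)"

definition informative_common_hinf ::
  "real^'M^'n \<Rightarrow> real^'M^'n \<Rightarrow> real^'N::{finite,linorder}^'M \<Rightarrow>
   (nat \<Rightarrow> real^'m) \<Rightarrow> (nat \<Rightarrow> real^'n) \<Rightarrow> real^'n^'p \<Rightarrow> real^'n^'p \<Rightarrow> real \<Rightarrow> bool" where
  "informative_common_hinf Cl Cu R u x C D \<gamma> \<longleftrightarrow>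
     (\<exists>K :: real^'n^'m. \<exists>P :: real^'n^'n. pos_def P \<and>
        (\<forall>(A, B) \<in> feasible_systems Cl Cu R u x.
           neg_def (hinf_matrix C D \<gamma> P (A + B ** K))))"

end

theory Submission
  imports Defs
begin

text \<open>
  Write \<open>S = [A B]\<close> and \<open>G = [X\<^sub>-; U\<^sub>-] R\<^sub>-\<^sup>T\<close>.  Eliminating the noise turns feasibility of \<open>S\<close> into the
  two-sided bound that \<open>S G / \<surd>N\<close> lies in a fixed order interval of matrices
  (\<open>feasible_systems_iff_interval\<close>).  The kernel condition says that \<open>G\<^sup>T\<close> is injective, hence so is
  the linear map \<open>S \<mapsto> S G / \<surd>N\<close>, and the preimage of a compact convex set under an injective
  linear map of finite-dimensional spaces is compact and convex.  By the Krein--Milman theorem in finite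
  dimension the feasible set is therefore the convex hull of its extreme points.

  It remains to see that an inequality at the vertices extends to their hull while \<open>K\<close> and \<open>P\<close> stay
  fixed.  At a vector \<open>(a, b)\<close> the quadratic form of the matrix inequality is
  \<open>- a\<^sup>TPa + (F a + b)\<^sup>T P (F a + b) - \<gamma>\<^sup>2 |b|\<^sup>2 + |C a + D b|\<^sup>2\<close>, where \<open>F = S [I; K]\<close>.  The closed-loop
  matrix \<open>F\<close> enters only the second term, which is convex in \<open>F\<close> because \<open>P\<close> is positive
  definite.  So the \<open>F\<close> at which the inequality holds form a convex set (\<open>convex_neg_def_hinf\<close>), and so
  do the \<open>S\<close>, on which \<open>F\<close> depends linearly.
\<close>

text \<open>Coordinates of a vector over a sum type, so that products with block matrices can be
  computed block by block.\<close>

definition upper :: "real^('a::finite + 'b::finite) \<Rightarrow> real^'a" where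
  "upper v = (\<chi> i. v $ Inl i)"

definition lower :: "real^('a::finite + 'b::finite) \<Rightarrow> real^'b" where
  "lower v = (\<chi> i. v $ Inr i)"

lemma sum_UNIV_Plus:
  fixes f :: "'a::finite + 'b::finite \<Rightarrow> 'c::comm_monoid_add"
  shows "sum f UNIV = (\<Sum>i\<in>UNIV. f (Inl i)) + (\<Sum>j\<in>UNIV. f (Inr j))"
  using sum.Plus[of UNIV UNIV f] by (simp add: comp_def)

lemma inner_upper_lower:
  fixes v w :: "real^('a::finite + 'b::finite)"
  shows "v \<bullet> w = upper v \<bullet> upper w + lower v \<bullet> lower w"
  by (simp add: inner_vec_def upper_def lower_def sum_UNIV_Plus)

lemma upper_vblock_mult [simp]: "upper (vblock A B *v v) = A *v v"
  and lower_vblock_mult [simp]: "lower (vblock A B *v v) = B *v v"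
  by (simp_all add: upper_def lower_def vblock_def matrix_vector_mult_def vec_eq_iff)

lemma hblock_mult_vector: "hblock A B *v v = A *v upper v + B *v lower v"
  by (simp add: upper_def lower_def hblock_def matrix_vector_mult_def vec_eq_iff sum_UNIV_Plus)

lemma hblock_mult_vblock: "hblock A B ** vblock X Y = A ** X + B ** Y"
  by (simp add: hblock_def vblock_def matrix_matrix_mult_def vec_eq_iff sum_UNIV_Plus)

lemma obtain_hblock:
  fixes S :: "real^('a::finite + 'b::finite)^'r"
  obtains A B where "S = hblock A B"
proof
  show "S = hblock (\<chi> i k. S $ i $ Inl k) (\<chi> i l. S $ i $ Inr l)"
    by (auto simp: hblock_def vec_eq_iff split: sum.split)
qed

lemma hblock_inject: "hblock A B = hblock A' B' \<longleftrightarrow> A = A' \<and> B = B'"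
  by (auto simp: hblock_def vec_eq_iff split: sum.splits)

lemma inner_diagblock:
  "v \<bullet> (diagblock A B *v v) = upper v \<bullet> (A *v upper v) + lower v \<bullet> (B *v lower v)"
  by (simp add: diagblock_def inner_upper_lower hblock_mult_vector)

lemma transpose_diagblock:
  "transpose (diagblock A B) = diagblock (transpose A) (transpose B)"
  by (auto simp: diagblock_def vblock_def hblock_def transpose_def vec_eq_iff split: sum.split)

lemma transpose_uminus: "transpose (- A) = - transpose (A :: real^'a^'b)"
  by (simp add: transpose_def vec_eq_iff)

lemma linear_matrix_mult_right: "linear (\<lambda>S :: real^'a^'r. S ** (G :: real^'b^'a))"
  by (rule linearI)
    (simp_all add: matrix_matrix_mult_def vec_eq_iff distrib_right sum.distrib sum_distrib_left mult.assoc)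

section \<open>Convexity of the matrix inequality in the closed-loop matrix\<close>

lemma hinf_matrix_symmetric:
  assumes "transpose P = P"
  shows "transpose (hinf_matrix C D \<gamma> P F) = hinf_matrix C D \<gamma> P F"
  using assms
  by (simp add: hinf_matrix_def Let_def matrix_transpose_mul transpose_diagblock
      transpose_uminus transpose_scalar matrix_mul_assoc)

lemma hinf_matrix_quadratic_form:
  fixes C D :: "real^'n^'p" and P F :: "real^'n^'n"
  defines "q \<equiv> \<lambda>w. w \<bullet> (P *v w)"
  shows "v \<bullet> (hinf_matrix C D \<gamma> P F *v v) =
    q (F *v upper v + lower v) - q (upper v) - \<gamma>\<^sup>2 * (lower v \<bullet> lower v)
      + (C *v upper v + D *v lower v) \<bullet> (C *v upper v + D *v lower v)"
proof -
  have congruence: "v \<bullet> ((transpose Z ** W ** Z) *v v) = (Z *v v) \<bullet> (W *v (Z *v v))"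
    for Z :: "real^('n + 'n)^('n + 'n + 'n + 'p)" and W
  proof -
    have "v \<bullet> ((transpose Z ** W ** Z) *v v) = v \<bullet> ((W *v (Z *v v)) v* Z)"
      by (simp flip: matrix_vector_mul_assoc)
    also have "\<dots> = (Z *v v) \<bullet> (W *v (Z *v v))"
      by (metis dot_lmul_matrix inner_commute)
    finally show ?thesis .
  qed
  have uminus: "(- A) *v w = - (A *v w)" for A :: "real^'n^'n" and w
    by (simp add: matrix_vector_mult_def vec_eq_iff sum_negf)
  show ?thesis
    unfolding hinf_matrix_def Let_def congruence q_def
    by (simp add: inner_diagblock hblock_mult_vector uminus scaleR_matrix_vector_assoc[symmetric])
qed

text \<open>The gap between the chord and the form at the convex combination is exactly \<open>s t\<close> times the
  form at \<open>y - z\<close>.\<close>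

lemma pos_def_form_convex:
  assumes P: "pos_def P" and st: "s \<ge> 0" "t \<ge> 0" "s + t = 1"
  defines "q \<equiv> \<lambda>w. w \<bullet> (P *v w)"
  shows "q (s *\<^sub>R y + t *\<^sub>R z) \<le> s * q y + t * q z"
proof -
  have "y \<bullet> (P *v z) = z \<bullet> (P *v y)"
    using P by (metis dot_lmul_matrix inner_commute pos_def_def transpose_matrix_vector)
  moreover have t: "t = 1 - s"
    using st by simp
  ultimately have "s * q y + t * q z - q (s *\<^sub>R y + t *\<^sub>R z) = s * t * q (y - z)"
    unfolding q_def t
    by (simp add: matrix_vector_right_distrib matrix_vector_mult_scaleR matrix_vector_mult_diff_distrib
        inner_add_left inner_add_right inner_diff_left inner_diff_right algebra_simps)
  moreover have "q (y - z) \<ge> 0"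
    using P by (cases "y - z = 0") (auto simp: q_def pos_def_def less_imp_le)
  ultimately show ?thesis
    using st by (smt (verit) mult_nonneg_nonneg)
qed

text \<open>For a fixed vector \<open>v\<close> the quadratic form is a convex function of \<open>F\<close>, and its strict sublevel
  sets are convex.\<close>

lemma convex_neg_def_hinf:
  fixes C D :: "real^'n^'p" and P :: "real^'n^'n"
  assumes P: "pos_def P"
  shows "convex {F. neg_def (hinf_matrix C D \<gamma> P F)}"
proof (rule convexI, clarsimp)
  fix F G :: "real^'n^'n" and s t :: real
  assume F: "neg_def (hinf_matrix C D \<gamma> P F)" and G: "neg_def (hinf_matrix C D \<gamma> P G)"
    and st: "0 \<le> s" "0 \<le> t" "s + t = 1"
  let ?h = "\<lambda>F v. v \<bullet> (hinf_matrix C D \<gamma> P F *v v)"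
  have "?h (s *\<^sub>R F + t *\<^sub>R G) v < 0" if v: "v \<noteq> 0" for v
  proof -
    let ?q = "\<lambda>w. w \<bullet> (P *v w)"
    let ?a = "upper v" and ?b = "lower v"
    have "(s *\<^sub>R F + t *\<^sub>R G) *v ?a + ?b = s *\<^sub>R (F *v ?a + ?b) + t *\<^sub>R (G *v ?a + ?b)"
    proof -
      have "?b = s *\<^sub>R ?b + t *\<^sub>R ?b"
        using st(3) by (simp flip: scaleR_left_distrib)
      then show ?thesis
        by (simp add: matrix_vector_mult_add_rdistrib scaleR_matrix_vector_assoc[symmetric]
            scaleR_add_right)
    qed
    then have q: "?q ((s *\<^sub>R F + t *\<^sub>R G) *v ?a + ?b) \<le> s * ?q (F *v ?a + ?b) + t * ?q (G *v ?a + ?b)"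
      using pos_def_form_convex[OF P st] by metis
    \<comment> \<open>the part of the form that does not depend on the closed-loop matrix\<close>
    define r where "r = - ?q ?a - \<gamma>\<^sup>2 * (?b \<bullet> ?b) + (C *v ?a + D *v ?b) \<bullet> (C *v ?a + D *v ?b)"
    have h: "?h H v = ?q (H *v ?a + ?b) + r" for H
      by (simp add: hinf_matrix_quadratic_form r_def)
    have "s * r + t * r = r"
      using st(3) by (metis distrib_right mult_1)
    then have "?h (s *\<^sub>R F + t *\<^sub>R G) v \<le> s * ?h F v + t * ?h G v"
      using q by (simp add: h distrib_left)
    moreover have "s * ?h F v + t * ?h G v < 0"
    proof -
      have "?h F v < 0" "?h G v < 0"
        using F G v by (auto simp: neg_def_def)
      then show ?thesis
        using convex_bound_lt[of "?h F v" 0 "?h G v" s t] st by simp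
    qed
    ultimately show ?thesis by simp
  qed
  then show "neg_def (hinf_matrix C D \<gamma> P (s *\<^sub>R F + t *\<^sub>R G))"
    using hinf_matrix_symmetric P by (auto simp: neg_def_def pos_def_def)
qed

section \<open>The feasible set as a polytope\<close>

lemma feasible_systems_iff_interval:
  fixes R :: "real^'N::{finite,linorder}^'M" and x :: "nat \<Rightarrow> real^'n" and u :: "nat \<Rightarrow> real^'m"
    and S :: "real^('n + 'm)^'n"
  defines "c \<equiv> 1 / sqrt (real CARD('N))"
    and "G \<equiv> vblock (data_minus x ** transpose R) (data_minus u ** transpose R)"
    and "Y \<equiv> (1 / sqrt (real CARD('N))) *\<^sub>R (data_plus x ** transpose R)"
  shows "S \<in> (\<lambda>(A, B). hblock A B) ` feasible_systems Cl Cu R u x \<longleftrightarrow>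
    c *\<^sub>R (S ** G) \<in> {Y - Cu..Y - Cl}"
proof -
  obtain A B where S: "S = hblock A B"
    by (rule obtain_hblock)
  \<comment> \<open>the only noise matrix with which \<open>(A, B)\<close> can explain the data\<close>
  define E :: "real^'N::{finite,linorder}^'n" where "E = data_plus x - A ** data_minus x - B ** data_minus u"
  have E: "c *\<^sub>R (E ** transpose R) = Y - c *\<^sub>R (S ** G)"
  proof -
    have "E ** transpose R = data_plus x ** transpose R - S ** G"
      unfolding E_def S G_def hblock_mult_vblock
      by (simp add: linear_diff[OF linear_matrix_mult_right] matrix_mul_assoc)
    then show ?thesis
      by (simp add: Y_def c_def scaleR_diff_right)
  qed
  have "S \<in> (\<lambda>(A, B). hblock A B) ` feasible_systems Cl Cu R u x \<longleftrightarrow> (A, B) \<in> feasible_systems Cl Cu R u x"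
    by (auto simp: S hblock_inject)
  also have "\<dots> \<longleftrightarrow> E \<in> noise_set Cl Cu R"
  proof -
    have "data_plus x = A ** data_minus x + B ** data_minus u + E' \<longleftrightarrow> E' = E" for E'
      by (auto simp: E_def algebra_simps)
    then show ?thesis
      by (simp add: feasible_systems_def)
  qed
  also have "\<dots> \<longleftrightarrow> c *\<^sub>R (S ** G) \<in> {Y - Cu..Y - Cl}"
    unfolding noise_set_def c_def[symmetric] using E by (auto simp: algebra_simps)
  finally show ?thesis .
qed

text \<open>Boundedness comes from a linear left inverse \<open>g\<close> of \<open>f\<close>: the preimage of \<open>T\<close> is contained in the
  compact set \<open>g ` T\<close>.\<close>

lemma compact_convex_injective_linear_vimage:
  fixes f :: "'a::euclidean_space \<Rightarrow> 'b::euclidean_space"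
  assumes f: "linear f" "inj f" and T: "compact T" "convex T"
  shows "compact (f -` T)" "convex (f -` T)"
proof -
  obtain g where g: "linear g" "g \<circ> f = id"
    using linear_injective_left_inverse[OF f] by blast
  have "g (f y) = y" for y
    using g(2) by (metis comp_apply id_apply)
  then have "f -` T \<subseteq> g ` T"
    by (metis imageI subsetI vimageD)
  moreover have "compact (g ` T)"
    using g(1) T(1) by (intro compact_continuous_image linear_continuous_on)
      (auto simp: linear_linear)
  moreover have "closed (f -` T)"
    using f(1) T(1) by (intro closed_vimage linear_continuous_on compact_imp_closed)
      (auto simp: linear_linear)
  ultimately show "compact (f -` T)"
    by (metis compact_Int_closed inf.absorb_iff2)
  show "convex (f -` T)"
    using f(1) T(2) by (rule convex_linear_vimage)
qed

text \<open>The rows of \<open>S G\<close> are the images under \<open>G\<^sup>T\<close> of the rows of \<open>S\<close>.\<close>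

lemma inj_matrix_mult_right:
  fixes G :: "real^'b^'a"
  assumes "{v. transpose G *v v = 0} = {0}"
  shows "inj (\<lambda>S :: real^'a^'r. S ** G)"
proof (rule injI)
  fix S T :: "real^'a^'r"
  assume "S ** G = T ** G"
  then have "transpose G *v (S $ i) = transpose G *v (T $ i)" for i
    by (simp add: matrix_matrix_mult_def matrix_vector_mult_def transpose_def vec_eq_iff mult.commute)
  then have "transpose G *v (S $ i - T $ i) = 0" for i
    by (simp add: matrix_vector_mult_diff_distrib)
  then show "S = T"
    using assms by (auto simp: vec_eq_iff set_eq_iff)
qed

lemma feasible_compact_convex:
  fixes R :: "real^'N::{finite,linorder}^'M" and x :: "nat \<Rightarrow> real^'n" and u :: "nat \<Rightarrow> real^'m"
    and Cl Cu :: "real^'M^'n"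
  assumes kernel: "{v. transpose (vblock (data_minus x ** transpose R)
                                         (data_minus u ** transpose R)) *v v = 0} = {0}"
  defines "\<Sigma> \<equiv> (\<lambda>(A, B). hblock A B) ` feasible_systems Cl Cu R u x"
  shows "compact \<Sigma>" "convex \<Sigma>"
proof -
  define G where "G = vblock (data_minus x ** transpose R) (data_minus u ** transpose R)"
  define c where "c = 1 / sqrt (real CARD('N))"
  define Y where "Y = c *\<^sub>R (data_plus x ** transpose R)"
  define f :: "real^('n + 'm)^'n \<Rightarrow> real^'M^'n" where "f = (\<lambda>S. c *\<^sub>R (S ** G))"
  have "\<Sigma> = f -` {Y - Cu..Y - Cl}"
    by (simp only: \<Sigma>_def f_def G_def c_def Y_def set_eq_iff vimage_eq
        feasible_systems_iff_interval simp_thms)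
  moreover have "linear f"
    unfolding f_def by (intro linear_compose_scale_right linear_matrix_mult_right)
  moreover have "inj f"
    using inj_matrix_mult_right[OF kernel[folded G_def], where 'r = 'n]
    by (auto simp: f_def c_def inj_def)
  moreover have "compact {Y - Cu..Y - Cl}" "convex {Y - Cu..Y - Cl}"
    by (simp_all flip: cbox_interval)
  ultimately show "compact \<Sigma>" "convex \<Sigma>"
    using compact_convex_injective_linear_vimage by metis+
qed

theorem proposition19:
  fixes x :: "nat \<Rightarrow> real^'n"
    and u :: "nat \<Rightarrow> real^'m"
    and R :: "real^'N::{finite,linorder}^'M"
    and Cl Cu :: "real^'M^'n"
    and A0 :: "real^'n^'n" and B0 :: "real^'m^'n" and E0 :: "real^'N::{finite,linorder}^'n"
    and C D :: "real^'n^'p"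
    and \<gamma> :: real
    and L :: nat
    and \<sigma> :: "nat \<Rightarrow> real^('n + 'm)^'n"
  assumes true_noise: "E0 \<in> noise_set Cl Cu R"
    and true_system: "data_plus x = A0 ** data_minus x + B0 ** data_minus u + E0"
    and kernel: "{v. transpose (vblock (data_minus x ** transpose R)
                                       (data_minus u ** transpose R)) *v v = 0} = {0}"
    and vertices: "\<sigma> ` {1..L} =
      {v. v extreme_point_of ((\<lambda>(A, B). hblock A B) ` feasible_systems Cl Cu R u x)}"
    and gamma: "\<gamma> > 0"
  shows "informative_common_hinf Cl Cu R u x C D \<gamma> \<longleftrightarrow>
    (\<exists>K :: real^'n^'m. \<exists>P :: real^'n^'n. pos_def P \<and>
       (\<forall>i \<in> {1..L}. neg_def (hinf_matrix C D \<gamma> P (\<sigma> i ** vblock (mat 1) K))))"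
proof -
  define \<Sigma> where "\<Sigma> = (\<lambda>(A, B). hblock A B) ` feasible_systems Cl Cu R u x"
  have hull: "\<Sigma> = convex hull (\<sigma> ` {1..L})"
    unfolding vertices \<Sigma>_def
    by (intro Krein_Milman_Minkowski feasible_compact_convex kernel)
  have "(\<forall>(A, B) \<in> feasible_systems Cl Cu R u x. neg_def (hinf_matrix C D \<gamma> P (A + B ** K))) \<longleftrightarrow>
      (\<forall>i \<in> {1..L}. neg_def (hinf_matrix C D \<gamma> P (\<sigma> i ** vblock (mat 1) K)))" (is "?all \<longleftrightarrow> ?vert")
    if P: "pos_def P" for K :: "real^'n^'m" and P
  proof -
    define T where "T = {S. neg_def (hinf_matrix C D \<gamma> P (S ** vblock (mat 1) K))}"
    have "convex T"
      using convex_linear_vimage[OF linear_matrix_mult_right convex_neg_def_hinf[OF P, of C D \<gamma>]]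
      by (simp add: T_def vimage_def)
    have "?all \<longleftrightarrow> \<Sigma> \<subseteq> T"
      by (auto simp: \<Sigma>_def T_def hblock_mult_vblock)
    also have "\<dots> \<longleftrightarrow> \<sigma> ` {1..L} \<subseteq> T"
      unfolding hull using \<open>convex T\<close> by (metis hull_minimal hull_subset subset_trans)
    also have "\<dots> \<longleftrightarrow> ?vert"
      by (auto simp: T_def)
    finally show ?thesis .
  qed
  then show ?thesis
    unfolding informative_common_hinf_def by blast
qed

end
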